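(* Let $N\ge 2$ and $\gamma>p-1>0$, and put $C_{p,\gamma}=\frac{\gamma-p+1}{p}$. Then, for every $u\in C_0^\infty(\mathbb{R}^N)$, $$C_{p,\gamma}^{p}\int_{\mathbb{R}^N_+}\frac{|u|^p}{(1+x_N)^{p-\gamma}}\,dx+C_{p,\gamma}^{p-1}\int_{\mathbb{R}^{N-1}}|u|^p\,dx'\le\int_{\mathbb{R}^N_+}(1+x_N)^\gamma|\nabla u|^p\,dx .$$
   Context: $\mathbb{R}^N_+=\{x=(x',x_N): x'\in\mathbb{R}^{N-1},\ x_N>0\}$, and its boundary $\{x_N=0\}$ is identified with $\mathbb{R}^{N-1}$, so that $\int_{\mathbb{R}^{N-1}}|u|^p\,dx'=\int_{\mathbb{R}^{N-1}}|u(x',0)|^p\,dx'$. *)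

theory Defs
  imports "HOL-Analysis.Analysis"
begin

text \<open>
  The space R^N with N \<ge> 2 is represented by the product \<^typ>\<open>(real ^ 'm) \<times> real\<close>, where
  N = CARD('m) + 1: a point is x = (x', x_N), with x' = \<^term>\<open>fst x\<close> and x_N = \<^term>\<open>snd x\<close>.
  As finite index types are nonempty, the condition N \<ge> 2 holds automatically and every such N
  occurs. The norm on the product is the Euclidean one, and its Lebesgue measure is that of R^N.
\<close>

definition upper_half_space :: "((real ^ 'm) \<times> real) set"
  where "upper_half_space = {x. snd x > 0}"

text \<open>\<open>Ck_fun k u\<close> says that u is of class C^k on the whole space; the clause for
  \<open>Suc k\<close> asks that u is differentiable and all its first partial derivatives are C^k.\<close>

primrec Ck_fun :: "nat \<Rightarrow> ('a::euclidean_space \<Rightarrow> real) \<Rightarrow> bool"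
  where
    "Ck_fun 0 u \<longleftrightarrow> continuous_on UNIV u"
  | "Ck_fun (Suc k) u \<longleftrightarrow>
       (\<forall>x. u differentiable (at x)) \<and>
       (\<forall>b\<in>Basis. Ck_fun k (\<lambda>x. frechet_derivative u (at x) b))"

definition test_functions :: "('a::euclidean_space \<Rightarrow> real) set"
  where "test_functions = {u. (\<forall>k. Ck_fun k u) \<and> compact (closure {x. u x \<noteq> 0})}"

definition gradient :: "('a::euclidean_space \<Rightarrow> real) \<Rightarrow> 'a \<Rightarrow> 'a"
  where "gradient u x = (\<Sum>b\<in>Basis. frechet_derivative u (at x) b *\<^sub>R b)"

lemma GDERIV_gradient:
  assumes "u differentiable (at x)"
  shows "GDERIV u x :> gradient u x"
proof -
  let ?D = "frechet_derivative u (at x)"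
  have D: "(u has_derivative ?D) (at x)"
    using assms by (simp add: frechet_derivative_works)
  then interpret linear ?D
    by (rule has_derivative_linear)
  have "?D h = h \<bullet> gradient u x" for h
  proof -
    have "?D h = ?D (\<Sum>b\<in>Basis. (h \<bullet> b) *\<^sub>R b)"
      by (simp add: euclidean_representation)
    also have "\<dots> = (\<Sum>b\<in>Basis. (h \<bullet> b) * ?D b)"
      by (simp add: sum scaleR)
    also have "\<dots> = h \<bullet> gradient u x"
      by (simp add: gradient_def inner_sum_right mult.commute)
    finally show ?thesis .
  qed
  then have "?D = (\<lambda>h. h \<bullet> gradient u x)"
    by (rule ext)
  with D show ?thesis
    by (simp add: gderiv_def)
qed

definition hardy_const :: "real \<Rightarrow> real \<Rightarrow> real"
  where "hardy_const p \<gamma> = (\<gamma> - p + 1) / p"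

end

theory Submission
  imports Defs
begin

text \<open>
  With \<open>a = \<gamma> - p + 1 = p C\<close>, Young's inequality applied to
  \<open>X = C (1 + t) powr ((\<gamma> - p) / p) \<bar>u\<bar>\<close> and \<open>Y = (1 + t) powr (\<gamma> / p) \<bar>\<nabla>u\<bar>\<close> bounds \<open>C powr p\<close>
  times the first integrand pointwise by the last one plus \<open>C powr (p - 1)\<close> times the normal derivative of
  \<open>(1 + t) powr a * \<bar>u\<bar> powr p\<close>. Integrating that derivative along each normal line gives minus
  the boundary value \<open>\<bar>u (x', 0)\<bar> powr p\<close>.
\<close>

section \<open>Real-variable tools: Young's inequality, powers of absolute values, half-line
  integrals\<close>

lemma Youngs_inequality_powr:
  fixes X Y p :: real
  assumes "p > 1" "X \<ge> 0" "Y \<ge> 0"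
  shows "p * X powr (p - 1) * Y \<le> (p - 1) * X powr p + Y powr p"
proof -
  \<comment> \<open>The conjugate exponent \<open>p / (p - 1)\<close> turns the factor
    \<open>X powr (p - 1)\<close> back into \<open>X powr p\<close>.\<close>
  have "Y * X powr (p - 1) \<le> Y powr p / p + (X powr (p - 1)) powr (p / (p - 1)) / (p / (p - 1))"
    using assms by (intro Youngs_inequality) (auto simp: field_simps)
  then have "Y * X powr (p - 1) \<le> Y powr p / p + X powr p / (p / (p - 1))"
    using assms by (simp add: powr_powr)
  then have "p * (Y * X powr (p - 1)) \<le> p * (Y powr p / p + X powr p / (p / (p - 1)))"
    using assms by (intro mult_left_mono) auto
  also have "p * (Y powr p / p + X powr p / (p / (p - 1))) = (p - 1) * X powr p + Y powr p"
    using assms by (simp add: field_simps)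
  finally show ?thesis
    by (simp add: mult_ac)
qed

text \<open>At 0 the difference quotient has absolute value
  \<open>\<bar>h\<bar> powr (p - 1)\<close>, which tends to 0 because \<open>p > 1\<close>. Hence
  \<open>\<bar>u\<bar> powr p\<close> can be differentiated across the zeros of \<open>u\<close>
  without regularization.\<close>

lemma has_real_derivative_abs_powr:
  fixes p y :: real
  assumes "p > 1"
  shows "((\<lambda>y. \<bar>y\<bar> powr p) has_real_derivative p * (sgn y * \<bar>y\<bar> powr (p - 1))) (at y)"
proof (cases "y = 0")
  case True
  have "((\<lambda>h::real. \<bar>h\<bar> powr (p - 1)) \<longlongrightarrow> \<bar>0\<bar> powr (p - 1)) (at 0)"
    using assms by (intro tendsto_powr' tendsto_intros) auto
  then have lim: "((\<lambda>h::real. norm (\<bar>h\<bar> powr (p - 1))) \<longlongrightarrow> 0) (at 0)"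
    using assms by simp
  have "(\<lambda>h. (\<bar>0 + h\<bar> powr p - \<bar>0\<bar> powr p) / h) \<midarrow>0\<rightarrow> (0::real)"
  proof (rule tendsto_norm_zero_cancel, rule Lim_transform_eventually[OF lim])
    show "\<forall>\<^sub>F h in at 0. norm (\<bar>h\<bar> powr (p - 1))
        = norm ((\<bar>0 + h\<bar> powr p - \<bar>0\<bar> powr p) / h)"
      by (auto simp: eventually_at_filter powr_diff)
  qed
  then show ?thesis
    using True by (simp add: DERIV_def)
next
  case False
  \<comment> \<open>On the open half-line of points with the sign of \<open>y\<close>, the absolute
    value is the linear map \<open>z \<mapsto> sgn y * z\<close>.\<close>
  have "(abs has_real_derivative sgn y) (at y)"
  proof (rule has_field_derivative_transform_within_open)
    show "((\<lambda>z. sgn y * z) has_real_derivative sgn y) (at y)"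
      by (auto intro!: derivative_eq_intros)
    show "open {z. sgn y * z > 0}"
      by (intro open_Collect_less continuous_intros)
  qed (use False in \<open>auto simp: sgn_if split: if_splits\<close>)
  then have "((\<lambda>y. \<bar>y\<bar> powr p) has_real_derivative \<bar>y\<bar> powr p * (0 * ln \<bar>y\<bar> + sgn y * p / \<bar>y\<bar>)) (at y)"
    using False by (intro DERIV_powr derivative_intros) auto
  then show ?thesis
    using False by (simp add: powr_diff mult_ac)
qed

text \<open>The jump of \<open>sgn\<close> at 0 is absorbed since \<open>q > 0\<close>: the product
  is the difference of the \<open>q\<close>-th powers of the positive and negative parts of
  \<open>f\<close>.\<close>

lemma continuous_sgn_abs_powr:
  fixes f :: "'a::topological_space \<Rightarrow> real"
  assumes "continuous_on S f" "q > 0"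
  shows "continuous_on S (\<lambda>x. sgn (f x) * \<bar>f x\<bar> powr q)"
proof -
  have eq: "(\<lambda>x. sgn (f x) * \<bar>f x\<bar> powr q) = (\<lambda>x. max (f x) 0 powr q - max (- f x) 0 powr q)"
    using assms(2) by (auto simp: fun_eq_iff sgn_if max_def)
  show ?thesis
    unfolding eq using assms by (intro continuous_intros continuous_on_powr') auto
qed

text \<open>Serves with \<open>A\<close> open and \<open>S\<close> the closed half-line or
  half-space, where the weights \<open>(1 + t) powr a\<close> are continuous. Since \<open>f\<close>
  vanishes on \<open>S - K\<close>, integrability over \<open>A\<close> reduces to the compact set
  \<open>K \<inter> S\<close>.\<close>

lemma set_integrable_compact_support:
  fixes f :: "'a::euclidean_space \<Rightarrow> real"
  assumes "compact K" "closed S" "continuous_on S f" "\<And>x. x \<in> S - K \<Longrightarrow> f x = 0"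
    and "A \<in> sets borel" "A \<subseteq> S"
  shows "set_integrable lborel A f"
proof -
  have "set_integrable lborel (K \<inter> S) f"
    unfolding set_integrable_def
    using assms by (intro borel_integrable_compact) (auto intro: continuous_on_subset)
  then have "set_integrable lborel (A \<inter> (K \<inter> S)) f"
    by (rule set_integrable_subset) (use assms in \<open>auto intro: compact_imp_closed borel_closed\<close>)
  moreover have "(\<lambda>x. indicat_real (A \<inter> (K \<inter> S)) x *\<^sub>R f x) = (\<lambda>x. indicat_real A x *\<^sub>R f x)"
    using assms by (auto simp: fun_eq_iff indicator_def)
  ultimately show ?thesis
    by (simp add: set_integrable_def)
qed

text \<open>Beyond \<open>R\<close> the integrand vanishes and the endpoint 0 is a null set, so the
  integral is the one over \<open>{0..R}\<close>, where \<open>F R = 0\<close>.\<close>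

lemma set_integral_FTC_eventually_zero:
  fixes F f :: "real \<Rightarrow> real"
  assumes "\<And>t. t \<ge> 0 \<Longrightarrow> (F has_real_derivative f t) (at t)"
    and "continuous_on {0..} f"
    and "\<And>t. t \<ge> R \<Longrightarrow> F t = 0" "\<And>t. t \<ge> R \<Longrightarrow> f t = 0" "R \<ge> 0"
  shows "(LINT t:{0<..}|lborel. f t) = - F 0"
proof -
  have "(LINT t|lborel. indicator {0..R} t *\<^sub>R f t) = F R - F 0"
    using assms by (intro integral_FTC_Icc)
      (auto intro: continuous_on_subset has_vector_derivative_at_within
        simp: has_real_derivative_iff_has_vector_derivative)
  moreover have "(LINT t:{0<..}|lborel. f t) = (LINT t|lborel. indicator {0..R} t *\<^sub>R f t)"
  proof -
    have int: "set_integrable lborel A f" if "A \<in> sets borel" "A \<subseteq> {0..}" for A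
      using assms that by (intro set_integrable_compact_support[of "{0..R}" "{0..}"]) auto
    show ?thesis
      unfolding set_lebesgue_integral_def
    proof (rule integral_cong_AE)
      show "AE t in lborel. indicator {0<..} t *\<^sub>R f t = indicator {0..R} t *\<^sub>R f t"
        using AE_lborel_singleton[of 0]
        by eventually_elim (use assms in \<open>auto simp: indicator_def\<close>)
    qed (auto intro!: borel_measurable_integrable int[unfolded set_integrable_def] simp del: real_scaleR_def measurable_lborel2)
  qed
  ultimately show ?thesis
    using assms by simp
qed


section \<open>Derivatives and supports of C^1 functions\<close>

lemma Ck_fun_derivative:
  assumes "Ck_fun (Suc 0) u"
  shows "(u has_derivative frechet_derivative u (at x)) (at x)"
    and "b \<in> Basis \<Longrightarrow> continuous_on S (\<lambda>x. frechet_derivative u (at x) b)"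
    and "continuous_on S (gradient u)"
    and "continuous_on S u"
proof -
  show D: "(u has_derivative frechet_derivative u (at x)) (at x)" for x
    using assms by (simp add: frechet_derivative_works)
  show c: "continuous_on S (\<lambda>x. frechet_derivative u (at x) b)" if "b \<in> Basis" for b
    using assms that by (auto intro: continuous_on_subset)
  show "continuous_on S (gradient u)"
    unfolding gradient_def by (intro continuous_intros c)
  show "continuous_on S u"
    using D by (intro has_derivative_continuous_on) (auto intro: has_derivative_at_withinI)
qed

lemma eq_0_outside_support:
  assumes "x \<notin> closure {x. u x \<noteq> 0}"
  shows "u x = 0"
  using assms closure_subset[of "{x. u x \<noteq> 0}"] by blast

lemma frechet_derivative_outside_support:
  assumes "x \<notin> closure {x. u x \<noteq> 0}"
  shows "frechet_derivative u (at x) = (\<lambda>_. 0)"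
proof -
  have "((\<lambda>_. 0) has_derivative (\<lambda>_. 0)) (at x)"
    by simp
  then have "(u has_derivative (\<lambda>_. 0)) (at x)"
  proof (rule has_derivative_transform_within_open)
    show "open (- closure {x. u x \<noteq> 0})" "x \<in> - closure {x. u x \<noteq> 0}"
      using assms by auto
    show "0 = u z" if "z \<in> - closure {x. u x \<noteq> 0}" for z
      using that eq_0_outside_support[of z u] by simp
  qed
  then show ?thesis
    by (metis frechet_derivative_at)
qed

lemma abs_frechet_derivative_le_gradient:
  assumes "b \<in> Basis"
  shows "\<bar>frechet_derivative u (at x) b\<bar> \<le> norm (gradient u x)"
proof -
  have "frechet_derivative u (at x) b = gradient u x \<bullet> b"
    using assms by (simp add: gradient_def inner_sum_left inner_Basis if_distrib cong: if_cong)
  then show ?thesis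
    using assms by (simp add: Basis_le_norm)
qed

section \<open>The flux and its integral over the half-space\<close>

lemma borel_upper_half_space: "upper_half_space \<in> sets borel"
  unfolding upper_half_space_def by (intro borel_open open_Collect_less continuous_intros)

text \<open>The derivative of \<open>(1 + x_N) powr a * \<bar>u\<bar> powr p\<close> in the normal
  direction \<open>(0, 1)\<close>, written out by the product and chain rules.\<close>

definition hardy_flux :: "real \<Rightarrow> real \<Rightarrow> ((real ^ 'm) \<times> real \<Rightarrow> real) \<Rightarrow> (real ^ 'm) \<times> real \<Rightarrow> real"
  where "hardy_flux p a u x =
    a * (1 + snd x) powr (a - 1) * \<bar>u x\<bar> powr p
    + (1 + snd x) powr a * (p * (sgn (u x) * \<bar>u x\<bar> powr (p - 1)) * frechet_derivative u (at x) (0, 1))"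

lemma has_real_derivative_hardy_flux:
  assumes u: "Ck_fun (Suc 0) u" and "p > 1" "t \<ge> 0"
  shows "((\<lambda>t. (1 + t) powr a * \<bar>u (y, t)\<bar> powr p) has_real_derivative hardy_flux p a u (y, t)) (at t)"
proof -
  let ?D = "frechet_derivative u (at (y, t))"
  have D: "(u has_derivative ?D) (at (y, t))"
    using Ck_fun_derivative(1)[OF u] .
  then interpret linear ?D
    by (rule has_derivative_linear)
  have "((\<lambda>t. (y, t)) has_derivative (\<lambda>h. (0, h))) (at t)"
    by (intro derivative_intros)
  from has_derivative_compose[OF this D]
  have "((\<lambda>t. u (y, t)) has_derivative (\<lambda>h. ?D (0, h))) (at t)" .
  \<comment> \<open>Linearity gives the derivative the form of a multiplication, as a real
    derivative requires.\<close>
  moreover have "?D (0, h) = ?D (0, 1) * h" for h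
    using scaleR[of h "(0, 1)"] by (simp add: mult.commute)
  then have "(\<lambda>h. ?D (0, h)) = (*) (?D (0, 1))"
    by (rule ext)
  ultimately have "((\<lambda>t. u (y, t)) has_real_derivative ?D (0, 1)) (at t)"
    unfolding has_field_derivative_def by (rule subst[rotated])
  from DERIV_chain2[OF has_real_derivative_abs_powr[OF \<open>p > 1\<close>] this]
  have d: "((\<lambda>t. \<bar>u (y, t)\<bar> powr p) has_real_derivative
      p * (sgn (u (y, t)) * \<bar>u (y, t)\<bar> powr (p - 1)) * ?D (0, 1)) (at t)" .
  have w: "((\<lambda>t. (1 + t) powr a) has_real_derivative a * (1 + t) powr (a - 1)) (at t)"
    using \<open>t \<ge> 0\<close> by (auto intro!: derivative_eq_intros simp: powr_diff)
  show ?thesis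
    using DERIV_mult[OF w d] by (simp add: hardy_flux_def algebra_simps)
qed

lemma continuous_on_hardy_flux:
  assumes u: "Ck_fun (Suc 0) u" and "p > 1"
  shows "continuous_on {x. snd x \<ge> 0} (hardy_flux p a u)"
  unfolding hardy_flux_def
  using \<open>p > 1\<close>
  by (intro continuous_intros continuous_on_powr' continuous_sgn_abs_powr Ck_fun_derivative[OF u])
    (auto simp: Basis_prod_def)

lemma integral_hardy_flux:
  fixes u :: "(real ^ 'm) \<times> real \<Rightarrow> real"
  assumes u: "Ck_fun (Suc 0) u" and "p > 1" and supp: "compact (closure {x. u x \<noteq> 0})"
  shows "set_integrable lborel upper_half_space (hardy_flux p a u)"
    and "(LINT x:upper_half_space|lborel. hardy_flux p a u x) = - (LINT x'|lborel. \<bar>u (x', 0)\<bar> powr p)"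
proof -
  define K where "K = closure {x. u x \<noteq> 0}"
  let ?f = "hardy_flux p a u"
  have u0: "u x = 0" if "x \<notin> K" for x
    using that unfolding K_def by (rule eq_0_outside_support)
  have f0: "?f x = 0" if "x \<notin> K" for x
    using u0[OF that] frechet_derivative_outside_support[of x u] that
    by (simp add: hardy_flux_def K_def)
  have K: "compact K"
    using supp by (simp add: K_def)
  show int: "set_integrable lborel upper_half_space ?f"
    using K f0 continuous_on_hardy_flux[OF u \<open>p > 1\<close>]
    by (intro set_integrable_compact_support[where K = K and S = "{x. snd x \<ge> 0}"]
        borel_upper_half_space) (auto simp: upper_half_space_def intro!: closed_Collect_le continuous_intros)
  from K obtain R where R: "R > 0" "\<And>x. x \<in> K \<Longrightarrow> norm x \<le> R"
    by (meson bounded_pos compact_imp_bounded)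
  \<comment> \<open>\<open>K\<close> may touch height \<open>R\<close>, so the cut-off is placed
    strictly above it.\<close>
  have outside: "(y, t) \<notin> K" if "t \<ge> R + 1" for y t
    using R(2)[of "(y, t)"] norm_snd_le[of t y] R(1) that by auto
  have inner: "(LINT t:{0<..}|lborel. ?f (y, t)) = - (\<bar>u (y, 0)\<bar> powr p)" for y
  proof -
    \<comment> \<open>The weight equals 1 on the boundary, so the result does not depend on
      \<open>a\<close>.\<close>
    have "(LINT t:{0<..}|lborel. ?f (y, t)) = - ((1 + 0) powr a * \<bar>u (y, 0)\<bar> powr p)"
    proof (rule set_integral_FTC_eventually_zero[where R = "R + 1"])
      show "continuous_on {0..} (\<lambda>t. ?f (y, t))"
        by (rule continuous_on_compose2[OF continuous_on_hardy_flux[OF u \<open>p > 1\<close>]])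
          (auto intro!: continuous_intros)
    qed (use R(1) outside u0 f0 in \<open>auto intro: has_real_derivative_hardy_flux[OF u \<open>p > 1\<close>]\<close>)
    then show ?thesis
      by simp
  qed
  \<comment> \<open>Fubini, justified by \<open>int\<close>, with the normal variable
    innermost.\<close>
  have "(LINT x:upper_half_space|lborel. ?f x)
      = (LINT y|lborel. LINT t|lborel. indicator upper_half_space (y, t) *\<^sub>R ?f (y, t))"
    using int unfolding set_lebesgue_integral_def set_integrable_def lborel_prod[symmetric]
    by (intro lborel_pair.integral_fst'[symmetric])
  also have "\<dots> = (LINT y|lborel. (LINT t:{0<..}|lborel. ?f (y, t)))"
    by (simp add: set_lebesgue_integral_def upper_half_space_def indicator_def)
  also have "\<dots> = - (LINT x'|lborel. \<bar>u (x', 0)\<bar> powr p)"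
    by (simp add: inner)
  finally show "(LINT x:upper_half_space|lborel. ?f x) = - (LINT x'|lborel. \<bar>u (x', 0)\<bar> powr p)" .
qed

text \<open>Since \<open>\<gamma> - p + 1 = p * C\<close>, the scaled flux contains \<open>p\<close>
  copies of the left-hand side. Young's inequality uses up \<open>p - 1\<close> of them to control
  the derivative term, and exactly one copy remains.\<close>

lemma hardy_pointwise:
  fixes u :: "(real ^ 'm) \<times> real \<Rightarrow> real"
  assumes "p > 1" "\<gamma> > p - 1" "snd x \<ge> 0"
  defines "C \<equiv> hardy_const p \<gamma>"
  shows "C powr p * (\<bar>u x\<bar> powr p / (1 + snd x) powr (p - \<gamma>))
    \<le> C powr (p - 1) * hardy_flux p (\<gamma> - p + 1) u x
      + (1 + snd x) powr \<gamma> * norm (gradient u x) powr p"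
proof -
  define s where "s = 1 + snd x"
  define v where "v = \<bar>u x\<bar>"
  define D where "D = frechet_derivative u (at x) (0, 1)"
  define g where "g = norm (gradient u x)"
  have s: "s > 0" and v: "v \<ge> 0" and g: "g \<ge> 0"
    using assms by (auto simp: s_def v_def g_def)
  have C: "C > 0" and pC: "\<gamma> - p + 1 = p * C"
    using assms by (auto simp: C_def hardy_const_def)
  have Cp: "C powr p = C * C powr (p - 1)"
    using C by (simp add: powr_diff)
  have Dg: "\<bar>D\<bar> \<le> g"
    unfolding D_def g_def by (rule abs_frechet_derivative_le_gradient) (auto simp: Basis_prod_def)
  \<comment> \<open>The weights in \<open>X powr (p - 1) * Y\<close> multiply to the weight in front
    of the derivative term of the flux.\<close>
  have "(\<gamma> - p) / p * (p - 1) + \<gamma> / p = \<gamma> - p + 1"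
    using \<open>p > 1\<close> by (simp add: field_simps)
  then have s_powr: "s powr ((\<gamma> - p) / p * (p - 1)) * s powr (\<gamma> / p) = s powr (\<gamma> - p + 1)"
    by (simp flip: powr_add)
  let ?X = "C * s powr ((\<gamma> - p) / p) * v" and ?Y = "s powr (\<gamma> / p) * g"
  have "p * ?X powr (p - 1) * ?Y \<le> (p - 1) * ?X powr p + ?Y powr p"
    using assms C v g by (intro Youngs_inequality_powr) auto
  also have "?X powr p = C powr p * s powr (\<gamma> - p) * v powr p"
    using C v \<open>p > 1\<close> by (simp add: powr_mult powr_powr)
  also have "?Y powr p = s powr \<gamma> * g powr p"
    using g \<open>p > 1\<close> by (simp add: powr_mult powr_powr)
  also have "p * ?X powr (p - 1) * ?Y =
      p * C powr (p - 1) * (s powr ((\<gamma> - p) / p * (p - 1)) * s powr (\<gamma> / p)) * v powr (p - 1) * g"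
    using C v by (simp add: powr_mult powr_powr)
  finally have young: "p * C powr (p - 1) * s powr (\<gamma> - p + 1) * v powr (p - 1) * g
      \<le> (p - 1) * (C powr p * s powr (\<gamma> - p) * v powr p) + s powr \<gamma> * g powr p"
    unfolding s_powr .
  \<comment> \<open>The flux carries the signed derivative \<open>?E\<close>, while Young's
    inequality was applied with \<open>g\<close>; the two are linked by
    \<open>- ?E \<le> g\<close>.\<close>
  let ?E = "sgn (u x) * D"
  have "\<bar>?E\<bar> \<le> g"
    using Dg g by (simp add: abs_mult sgn_if)
  then have "- ?E \<le> g"
    by linarith
  then have "p * C powr (p - 1) * s powr (\<gamma> - p + 1) * v powr (p - 1) * (- ?E)
      \<le> p * C powr (p - 1) * s powr (\<gamma> - p + 1) * v powr (p - 1) * g"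
    using \<open>p > 1\<close> by (intro mult_left_mono) auto
  also note young
  finally have le: "C powr p * s powr (\<gamma> - p) * v powr p
      \<le> p * (C powr p * s powr (\<gamma> - p) * v powr p)
        + p * C powr (p - 1) * s powr (\<gamma> - p + 1) * v powr (p - 1) * ?E + s powr \<gamma> * g powr p"
    by (simp add: algebra_simps)
  have "C powr (p - 1) * hardy_flux p (\<gamma> - p + 1) u x
      = p * (C powr p * s powr (\<gamma> - p) * v powr p)
        + p * C powr (p - 1) * s powr (\<gamma> - p + 1) * v powr (p - 1) * ?E"
    \<comment> \<open>The exponent \<open>\<gamma> - p + 1 - 1\<close> is simplified to
      \<open>\<gamma> - p\<close> first; rewriting with \<open>pC\<close> earlier would turn it into
      \<open>p * C - 1\<close>.\<close>
    unfolding hardy_flux_def add_diff_cancel_right' s_def[symmetric] v_def[symmetric] D_def[symmetric] Cp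
    unfolding pC by (simp add: algebra_simps)
  moreover have "v powr p / s powr (p - \<gamma>) = s powr (\<gamma> - p) * v powr p"
    using s by (simp add: powr_diff)
  ultimately show ?thesis
    using le by (simp add: s_def v_def g_def mult.assoc)
qed

section \<open>Integration of the pointwise bound\<close>

theorem theorem2p10:
  fixes u :: "(real ^ 'm) \<times> real \<Rightarrow> real" and p \<gamma> :: real
  assumes "p - 1 > 0" and "\<gamma> > p - 1"
    and "u \<in> test_functions"
  shows "hardy_const p \<gamma> powr p *
           (LINT x:upper_half_space|lborel. \<bar>u x\<bar> powr p / (1 + snd x) powr (p - \<gamma>))
         + hardy_const p \<gamma> powr (p - 1) * (LINT x'|lborel. \<bar>u (x', 0)\<bar> powr p)
         \<le> (LINT x:upper_half_space|lborel. (1 + snd x) powr \<gamma> * norm (gradient u x) powr p)"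
proof -
  let ?H = "upper_half_space :: ((real ^ 'm) \<times> real) set"
  let ?S = "{x :: (real ^ 'm) \<times> real. snd x \<ge> 0}"
  define K where "K = closure {x. u x \<noteq> 0}"
  let ?C = "hardy_const p \<gamma>"
  let ?A = "\<lambda>x. \<bar>u x\<bar> powr p / (1 + snd x) powr (p - \<gamma>)"
  let ?f = "hardy_flux p (\<gamma> - p + 1) u"
  let ?G = "\<lambda>x. (1 + snd x) powr \<gamma> * norm (gradient u x) powr p"
  have p: "p > 1" and u: "Ck_fun (Suc 0) u" and K: "compact K"
    using assms unfolding test_functions_def K_def by (auto simp del: Ck_fun.simps)
  have C: "?C > 0"
    using assms by (simp add: hardy_const_def)
  have H: "?H \<in> sets borel" "?H \<subseteq> ?S" "closed ?S"
    using borel_upper_half_space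
    by (auto simp: upper_half_space_def intro!: closed_Collect_le continuous_intros)
  have u0: "u x = 0" "gradient u x = 0" if "x \<notin> K" for x
    using that eq_0_outside_support[of x u] frechet_derivative_outside_support[of x u]
    by (simp_all add: gradient_def K_def)
  \<comment> \<open>Monotonicity and additivity of the integral call for integrable terms. On
    \<open>?S\<close> the base \<open>1 + snd x\<close> is at least 1, so both weights are
    continuous whatever the sign of their exponents.\<close>
  have "continuous_on ?S ?A"
    using p by (intro continuous_on_divide continuous_on_powr' continuous_on_rabs continuous_on_add
      continuous_on_const continuous_on_snd continuous_on_id Ck_fun_derivative(4)[OF u]) auto
  then have A: "set_integrable lborel ?H ?A"
    by (rule set_integrable_compact_support[OF K H(3) _ _ H(1,2)]) (use p u0 in simp)
  have "continuous_on ?S ?G"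
    using p by (intro continuous_on_mult continuous_on_powr' continuous_on_norm continuous_on_add
      continuous_on_const continuous_on_snd continuous_on_id Ck_fun_derivative(3)[OF u]) auto
  then have G: "set_integrable lborel ?H ?G"
    by (rule set_integrable_compact_support[OF K H(3) _ _ H(1,2)]) (use p u0 in simp)
  note f = integral_hardy_flux[OF u p K[unfolded K_def], of "\<gamma> - p + 1"]
  have "(LINT x:?H|lborel. ?C powr p * ?A x) \<le> (LINT x:?H|lborel. ?C powr (p - 1) * ?f x + ?G x)"
  proof (rule set_integral_mono)
    show "?C powr p * ?A x \<le> ?C powr (p - 1) * ?f x + ?G x" if "x \<in> ?H" for x
      using that p assms(2) by (intro hardy_pointwise) (auto simp: upper_half_space_def)
  qed (intro set_integral_add set_integrable_mult_right A G f(1))+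
  also have "\<dots> = (LINT x:?H|lborel. ?C powr (p - 1) * ?f x) + (LINT x:?H|lborel. ?G x)"
    by (intro set_integral_add set_integrable_mult_right G f(1))
  \<comment> \<open>The flux integral is minus the boundary integral, so its term moves to the left
    with the factor \<open>?C powr (p - 1)\<close>.\<close>
  finally show ?thesis
    unfolding set_integral_mult_right f(2) by simp
qed

end
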